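(* Assume the self-similar set $K$ is connected and that there exists $\beta>\alpha$ such that $\mathcal D_K^{(\beta)}$ contains nonconstant functions. Then $\beta_2^*=\beta_3^*$.
   Context: Let $\{S_i\}_{i=1}^N$ ($N\ge2$) be contractive similitudes of $\mathbb R^d$ with ratios $r_i\in(0,1)$ satisfying the open set condition; $K$ is the self-similar set, $\alpha$ its Hausdorff dimension ($\sum_i r_i^\alpha=1$), $\nu$ the normalized $\alpha$-dimensional Hausdorff measure on $K$, $r=\min_ir_i$. For $\beta>0$ let $\mathcal D_K^{(\beta)}$ be the Besov space $\Lambda^{\alpha,\beta/2}_{2,2}=\{u\in L^2(K,\nu):\iint_{K\times K}|u(\xi)-u(\eta)|^2|\xi-\eta|^{-(\alpha+\beta)}d\nu(\xi)d\nu(\eta)<\infty\}$ (it is the domain of the energy form induced on $K$ by the $\lambda$-natural random walk on the augmented tree of $K$, with $\lambda=r^\beta$). Define $\beta_2^*=\sup\{\beta>0:\dim\mathcal D_K^{(\beta)}=\infty\}$ and $\beta_3^*=\sup\{\beta>0:\mathcal D_K^{(\beta)}$ contains nonconstant functions$\}$. *)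

theory Defs
  imports "HOL-Analysis.Analysis" "HOL-Probability.Probability"
begin

definition similitude :: "('a::metric_space \<Rightarrow> 'a) \<Rightarrow> real \<Rightarrow> bool" where
  "similitude S \<rho> \<longleftrightarrow> (\<forall>x y. dist (S x) (S y) = \<rho> * dist x y)"

definition open_set_condition :: "nat \<Rightarrow> (nat \<Rightarrow> 'a::metric_space \<Rightarrow> 'a) \<Rightarrow> bool" where
  "open_set_condition N S \<longleftrightarrow>
     (\<exists>V. open V \<and> bounded V \<and> V \<noteq> {} \<and> (\<forall>i<N. S i ` V \<subseteq> V) \<and>
          (\<forall>i<N. \<forall>j<N. i \<noteq> j \<longrightarrow> S i ` V \<inter> S j ` V = {}))"

definition self_similar_set :: "nat \<Rightarrow> (nat \<Rightarrow> 'a::metric_space \<Rightarrow> 'a) \<Rightarrow> 'a set \<Rightarrow> bool" where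
  "self_similar_set N S K \<longleftrightarrow> compact K \<and> K \<noteq> {} \<and> K = (\<Union>i<N. S i ` K)"

definition hausdorff_pre :: "real \<Rightarrow> real \<Rightarrow> 'a::metric_space set \<Rightarrow> ennreal" where
  "hausdorff_pre \<delta> s A =
     (INF C \<in> {C :: nat \<Rightarrow> 'a set. A \<subseteq> (\<Union>n. C n) \<and> (\<forall>n. bounded (C n) \<and> diameter (C n) \<le> \<delta>)}.
        (\<Sum>n. ennreal (diameter (C n) powr s)))"

definition hausdorff_outer :: "real \<Rightarrow> 'a::metric_space set \<Rightarrow> ennreal" where
  "hausdorff_outer s A = (SUP \<delta> \<in> {0<..}. hausdorff_pre \<delta> s A)"

definition normalized_hausdorff :: "real \<Rightarrow> 'a::metric_space set \<Rightarrow> 'a measure" where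
  "normalized_hausdorff s K =
     measure_of K (sets (restrict_space borel K)) (\<lambda>A. hausdorff_outer s A / hausdorff_outer s K)"

definition besov_space :: "'a::metric_space measure \<Rightarrow> real \<Rightarrow> real \<Rightarrow> ('a \<Rightarrow> real) set" where
  "besov_space \<nu> \<alpha> \<beta> =
     {u. u \<in> borel_measurable \<nu> \<and> integrable \<nu> (\<lambda>x. (u x)^2) \<and>
         (\<integral>\<^sup>+ x. (\<integral>\<^sup>+ y. ennreal ((u x - u y)^2 * dist x y powr (-(\<alpha> + \<beta>))) \<partial>\<nu>) \<partial>\<nu>) < \<infinity>}"

text \<open>The space D (a set of functions, considered modulo nu-a.e. equality) is infinite-dimensional:
  for every n it contains n elements linearly independent as elements of L^2(nu).\<close>
definition ae_infinite_dimensional :: "'a measure \<Rightarrow> ('a \<Rightarrow> real) set \<Rightarrow> bool" where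
  "ae_infinite_dimensional \<nu> D \<longleftrightarrow>
     (\<forall>n. \<exists>u :: nat \<Rightarrow> 'a \<Rightarrow> real. (\<forall>i<n. u i \<in> D) \<and>
        (\<forall>c :: nat \<Rightarrow> real. (AE x in \<nu>. (\<Sum>i<n. c i * u i x) = 0) \<longrightarrow> (\<forall>i<n. c i = 0)))"

definition ae_has_nonconstant :: "'a measure \<Rightarrow> ('a \<Rightarrow> real) set \<Rightarrow> bool" where
  "ae_has_nonconstant \<nu> D \<longleftrightarrow> (\<exists>u\<in>D. \<forall>c. \<not> (AE x in \<nu>. u x = c))"

definition beta2_star :: "'a::metric_space measure \<Rightarrow> real \<Rightarrow> ereal" where
  "beta2_star \<nu> \<alpha> = Sup (ereal ` {\<beta>. \<beta> > 0 \<and> ae_infinite_dimensional \<nu> (besov_space \<nu> \<alpha> \<beta>)})"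

definition beta3_star :: "'a::metric_space measure \<Rightarrow> real \<Rightarrow> ereal" where
  "beta3_star \<nu> \<alpha> = Sup (ereal ` {\<beta>. \<beta> > 0 \<and> ae_has_nonconstant \<nu> (besov_space \<nu> \<alpha> \<beta>)})"

end

theory Submission
  imports Defs
begin

text \<open>Scaling of the Hausdorff measure under the similitudes gives the lower bound
  \<open>\<nu> (ball x \<rho>) \<ge> c * \<rho> powr \<alpha>\<close> for \<open>x \<in> K\<close>. With it, for \<open>\<beta> > \<alpha>\<close> and connected \<open>K\<close>, the essential
  range of a function of finite energy has no gaps: a jump between two sets of positive measure
  costs infinite energy. So if \<open>u\<close> is nonconstant, its essential range contains an interval, and
  composing \<open>u\<close> with tent functions supported on disjoint subintervals, which does not increase
  the energy, gives arbitrarily many independent elements of the same Besov space.\<close>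

section \<open>Hausdorff measure under similitudes and its lower bound on balls\<close>

text \<open>Covers are pulled back by preimages because \<open>f\<close> need not be onto. A set
  that misses the range has empty preimage, of diameter 0.\<close>

lemma diameter_vimage_similitude:
  fixes f :: "'a::metric_space \<Rightarrow> 'a"
  assumes f: "similitude f \<rho>" and \<rho>: "0 < \<rho>" and C: "bounded C"
  shows "bounded (f -` C)" "diameter (f -` C) \<le> diameter C / \<rho>"
proof -
  have d: "dist x y \<le> diameter C / \<rho>" if "f x \<in> C" "f y \<in> C" for x y
    using diameter_bounded_bound[OF C that] f \<rho>
    by (simp add: similitude_def field_simps)
  show "bounded (f -` C)"
  proof (cases "f -` C = {}")
    case False
    then obtain x where "f x \<in> C" by blast
    then show ?thesis using d by (auto simp: bounded_def)
  qed simp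
  show "diameter (f -` C) \<le> diameter C / \<rho>"
  proof (cases "f -` C = {}")
    case True
    then show ?thesis using diameter_ge_0[OF C] \<rho> by simp
  next
    case False
    then have "diameter (f -` C) = (SUP (x, y)\<in>(f -` C) \<times> (f -` C). dist x y)"
      by (simp add: diameter_def)
    also have "\<dots> \<le> diameter C / \<rho>"
      using False d by (auto intro!: cSUP_least)
    finally show ?thesis .
  qed
qed

lemma hausdorff_outer_mono:
  assumes "A \<subseteq> B"
  shows "hausdorff_outer s A \<le> hausdorff_outer s B"
  unfolding hausdorff_outer_def hausdorff_pre_def
  using order_trans[OF assms] by (intro SUP_mono' INF_superset_mono) auto

text \<open>A cover of the image with mesh \<open>\<rho> * \<delta>\<close> pulls back to a cover of
  \<open>A\<close> with mesh \<open>\<delta>\<close>, and the factor \<open>\<rho> powr s\<close>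
  compensates the growth of each term. Rescaling \<open>\<delta>\<close> is harmless, since the
  supremum runs over all positive meshes.\<close>

lemma hausdorff_outer_similitude_image:
  fixes f :: "'a::metric_space \<Rightarrow> 'a"
  assumes f: "similitude f \<rho>" and \<rho>: "0 < \<rho>" and s: "0 \<le> s"
  shows "ennreal (\<rho> powr s) * hausdorff_outer s A \<le> hausdorff_outer s (f ` A)"
proof -
  have pre: "ennreal (\<rho> powr s) * hausdorff_pre \<delta> s A \<le> hausdorff_pre (\<rho> * \<delta>) s (f ` A)" for \<delta>
    unfolding hausdorff_pre_def[of "\<rho> * \<delta>"]
  proof (rule INF_greatest)
    fix C :: "nat \<Rightarrow> 'a set"
    assume "C \<in> {C. f ` A \<subseteq> (\<Union>n. C n) \<and> (\<forall>n. bounded (C n) \<and> diameter (C n) \<le> \<rho> * \<delta>)}"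
    then have cov: "f ` A \<subseteq> (\<Union>n. C n)" and b: "\<And>n. bounded (C n)"
      and dC: "\<And>n. diameter (C n) \<le> \<rho> * \<delta>" by auto
    have cov': "A \<subseteq> (\<Union>n. f -` C n)" using cov by blast
    note D = diameter_vimage_similitude[OF f \<rho> b]
    have "diameter (f -` C n) \<le> \<delta>" for n
      using order_trans[OF D(2) divide_right_mono[OF dC, of \<rho>]] \<rho> by simp
    then have "hausdorff_pre \<delta> s A \<le> (\<Sum>n. ennreal (diameter (f -` C n) powr s))"
      unfolding hausdorff_pre_def using D(1) cov' by (intro INF_lower) auto
    then have "ennreal (\<rho> powr s) * hausdorff_pre \<delta> s A
        \<le> ennreal (\<rho> powr s) * (\<Sum>n. ennreal (diameter (f -` C n) powr s))"
      by (rule mult_left_mono) simp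
    also have "\<dots> = (\<Sum>n. ennreal (\<rho> powr s) * ennreal (diameter (f -` C n) powr s))"
      by simp
    also have "\<dots> \<le> (\<Sum>n. ennreal (diameter (C n) powr s))"
    proof (rule suminf_le)
      fix n
      have "\<rho> powr s * diameter (f -` C n) powr s = (\<rho> * diameter (f -` C n)) powr s"
        using \<rho> diameter_ge_0[OF D(1)] by (simp add: powr_mult)
      also have "\<dots> \<le> diameter (C n) powr s"
        using \<rho> s D(2)[of n] diameter_ge_0[OF D(1)]
        by (intro powr_mono2) (auto simp: field_simps)
      finally show "ennreal (\<rho> powr s) * ennreal (diameter (f -` C n) powr s)
          \<le> ennreal (diameter (C n) powr s)"
        by (simp add: ennreal_mult[symmetric])
    qed auto
    finally show "ennreal (\<rho> powr s) * hausdorff_pre \<delta> s A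
        \<le> (\<Sum>n. ennreal (diameter (C n) powr s))" .
  qed
  show ?thesis
    unfolding hausdorff_outer_def SUP_mult_left_ennreal
  proof (rule SUP_mono)
    fix \<delta> :: real assume "\<delta> \<in> {0<..}"
    then show "\<exists>\<delta>'\<in>{0<..}. ennreal (\<rho> powr s) * hausdorff_pre \<delta> s A
        \<le> hausdorff_pre \<delta>' s (f ` A)"
      using \<rho> by (intro bexI[of _ "\<rho> * \<delta>"] pre) auto
  qed
qed

text \<open>If \<open>x = S i y\<close>, then \<open>S i\<close> maps the part of \<open>K\<close>
  in the ball of radius \<open>\<rho> / r i\<close> about \<open>y\<close> into the ball of radius
  \<open>\<rho>\<close> about \<open>x\<close>. So the bound passes from the larger radius to the
  smaller one with factor \<open>r i powr \<alpha>\<close>, and finitely many enlargements reach a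
  ball that contains \<open>K\<close>. Keeping the measure of \<open>K\<close> as a factor on the
  left covers the values 0 and infinity too.\<close>

lemma hausdorff_outer_ball_ge:
  fixes S :: "nat \<Rightarrow> 'a::metric_space \<Rightarrow> 'a"
  assumes S: "\<forall>i<N. 0 < r i \<and> r i < 1 \<and> similitude (S i) (r i)"
    and K: "self_similar_set N S K" and \<alpha>: "0 \<le> \<alpha>"
  shows "\<exists>c>0. \<exists>D>0. \<forall>x\<in>K. \<forall>\<rho>. 0 < \<rho> \<longrightarrow> \<rho> \<le> D \<longrightarrow>
           ennreal (c * \<rho> powr \<alpha>) * hausdorff_outer \<alpha> K \<le> hausdorff_outer \<alpha> (K \<inter> ball x \<rho>)"
proof -
  have bK: "bounded K" and ne: "K \<noteq> {}" and KU: "K = (\<Union>i<N. S i ` K)"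
    using K by (auto simp: self_similar_set_def compact_imp_bounded)
  have N: "{..<N} \<noteq> {}" using ne KU by auto
  \<comment> \<open>Adding 1 makes every open ball of radius \<open>D\<close> centred in
    \<open>K\<close> contain \<open>K\<close>, and keeps \<open>D\<close> positive when
    \<open>K\<close> is a single point.\<close>
  define D where "D = diameter K + 1"
  have D: "0 < D" using diameter_ge_0[OF bK] by (simp add: D_def)
  define p where "p = Min (r ` {..<N})"
  define q where "q = Max (r ` {..<N})"
  have "p \<in> r ` {..<N}" "q \<in> r ` {..<N}"
    using N by (auto simp: p_def q_def intro!: Min_in Max_in)
  then have p: "0 < p" "p < 1" and q: "0 < q" "q < 1" using S by auto
  have pq: "p \<le> r i" "r i \<le> q" if "i < N" for i
    using that by (auto simp: p_def q_def)
  \<comment> \<open>This gives \<open>c * \<rho> powr \<alpha> \<le> 1\<close> up to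
    \<open>\<rho> = D / p\<close>, which bounds every radius obtained by dividing one below
    \<open>D\<close> by a ratio.\<close>
  define c where "c = (p / D) powr \<alpha>"
  have c: "0 < c" using p D by (simp add: c_def)
  have big: "ennreal (c * \<rho> powr \<alpha>) * hausdorff_outer \<alpha> K \<le> hausdorff_outer \<alpha> (K \<inter> ball x \<rho>)"
    if "x \<in> K" "D \<le> \<rho>" "\<rho> \<le> D / p" for x \<rho>
  proof -
    have "K \<inter> ball x \<rho> = K"
      using that diameter_bounded_bound[OF bK \<open>x \<in> K\<close>] by (force simp: D_def)
    moreover have "c * \<rho> powr \<alpha> \<le> 1"
    proof -
      have "c * \<rho> powr \<alpha> = (p / D * \<rho>) powr \<alpha>"
        using p D that powr_mult[of "p / D" \<rho> \<alpha>] by (simp add: c_def)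
      also have "\<dots> \<le> 1 powr \<alpha>"
        using p D that \<alpha> by (intro powr_mono2) (auto simp: field_simps)
      finally show ?thesis by simp
    qed
    then have "ennreal (c * \<rho> powr \<alpha>) * hausdorff_outer \<alpha> K \<le> 1 * hausdorff_outer \<alpha> K"
      by (intro mult_right_mono) (auto simp: ennreal_le_1)
    ultimately show ?thesis by simp
  qed
  \<comment> \<open>Here \<open>n\<close> bounds the number of enlargements, each by a factor of at
    least \<open>1 / q\<close>. An enlargement is made only below \<open>D\<close>, so the bound
    \<open>D / p\<close> is preserved.\<close>
  have main: "ennreal (c * \<rho> powr \<alpha>) * hausdorff_outer \<alpha> K \<le> hausdorff_outer \<alpha> (K \<inter> ball x \<rho>)"
    if "x \<in> K" "D * q ^ n \<le> \<rho>" "\<rho> \<le> D / p" for n x \<rho>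
    using that
  proof (induction n arbitrary: x \<rho>)
    case 0
    then show ?case using big by simp
  next
    case (Suc n)
    show ?case
    proof (cases "D \<le> \<rho>")
      case True
      then show ?thesis using big Suc.prems by simp
    next
      case False
      obtain i y where i: "i < N" and y: "y \<in> K" "x = S i y"
        using \<open>x \<in> K\<close> KU by blast
      have ri: "0 < r i" "similitude (S i) (r i)" using S i by auto
      have \<rho>: "0 < \<rho>" using Suc.prems(2) D q by (smt (verit) mult_pos_pos zero_less_power)
      have "D * q ^ n * r i \<le> D * q ^ n * q"
        using D q pq[OF i] by (intro mult_left_mono) auto
      then have "D * q ^ n \<le> \<rho> / r i" using Suc.prems(2) ri by (simp add: field_simps)
      moreover have "\<rho> / r i \<le> D / p"
        using False p pq[OF i] \<rho> by (intro frac_le) auto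
      ultimately have IH: "ennreal (c * (\<rho> / r i) powr \<alpha>) * hausdorff_outer \<alpha> K
          \<le> hausdorff_outer \<alpha> (K \<inter> ball y (\<rho> / r i))"
        using Suc.IH[OF y(1)] by blast
      have "c * \<rho> powr \<alpha> = r i powr \<alpha> * (c * (\<rho> / r i) powr \<alpha>)"
        using ri \<rho> by (simp add: powr_divide)
      then have "ennreal (c * \<rho> powr \<alpha>) * hausdorff_outer \<alpha> K
          = ennreal (r i powr \<alpha>) * (ennreal (c * (\<rho> / r i) powr \<alpha>) * hausdorff_outer \<alpha> K)"
        using c by (simp add: ennreal_mult mult_ac)
      also have "\<dots> \<le> ennreal (r i powr \<alpha>) * hausdorff_outer \<alpha> (K \<inter> ball y (\<rho> / r i))"
        by (intro mult_left_mono IH) simp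
      also have "\<dots> \<le> hausdorff_outer \<alpha> (S i ` (K \<inter> ball y (\<rho> / r i)))"
        using ri \<alpha> by (intro hausdorff_outer_similitude_image)
      also have "\<dots> \<le> hausdorff_outer \<alpha> (K \<inter> ball x \<rho>)"
      proof (rule hausdorff_outer_mono)
        have "S i z \<in> K" if "z \<in> K" for z using that i KU by blast
        then show "S i ` (K \<inter> ball y (\<rho> / r i)) \<subseteq> K \<inter> ball x \<rho>"
          using ri y by (auto simp: similitude_def field_simps)
      qed
      finally show ?thesis .
    qed
  qed
  have "ennreal (c * \<rho> powr \<alpha>) * hausdorff_outer \<alpha> K \<le> hausdorff_outer \<alpha> (K \<inter> ball x \<rho>)"
    if "x \<in> K" "0 < \<rho>" "\<rho> \<le> D" for x \<rho>
  proof -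
    have "0 < \<rho> / D" using that D by simp
    then obtain n where "q ^ n < \<rho> / D" using real_arch_pow_inv[of "\<rho> / D" q] q by blast
    moreover have "\<rho> * p \<le> D * 1" using that D p by (intro mult_mono) auto
    ultimately show ?thesis
      using that D p by (intro main[of _ n]) (auto simp: field_simps)
  qed
  then show ?thesis using c D by blast
qed

section \<open>Separated nets and a covering estimate\<close>

text \<open>The common bound on cardinalities provides a separated set of largest size. A point
  outside all its balls could be added to it.\<close>

lemma exists_maximal_separated_set:
  fixes K :: "'a::metric_space set"
  assumes \<rho>: "0 < \<rho>"
    and bound: "\<And>F. finite F \<Longrightarrow> F \<subseteq> K \<Longrightarrow> (\<forall>x\<in>F. \<forall>y\<in>F. x \<noteq> y \<longrightarrow> \<rho> \<le> dist x y) \<Longrightarrow> card F \<le> n"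
  shows "\<exists>F. finite F \<and> F \<subseteq> K \<and> (\<forall>x\<in>F. \<forall>y\<in>F. x \<noteq> y \<longrightarrow> \<rho> \<le> dist x y) \<and> K \<subseteq> (\<Union>x\<in>F. ball x \<rho>)"
proof -
  define P where "P F \<longleftrightarrow> finite F \<and> F \<subseteq> K \<and> (\<forall>x\<in>F. \<forall>y\<in>F. x \<noteq> y \<longrightarrow> \<rho> \<le> dist x y)" for F
  have "P {}" by (simp add: P_def)
  moreover have "\<forall>F. P F \<longrightarrow> card F < Suc n" using bound by (auto simp: P_def less_Suc_eq_le)
  ultimately obtain F where F: "P F" and max: "\<And>G. P G \<Longrightarrow> card G \<le> card F"
    using ex_has_greatest_nat[of P "{}" card "Suc n"] by auto
  have "K \<subseteq> (\<Union>x\<in>F. ball x \<rho>)"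
  proof
    fix z assume z: "z \<in> K"
    show "z \<in> (\<Union>x\<in>F. ball x \<rho>)"
    proof (rule ccontr)
      assume "z \<notin> (\<Union>x\<in>F. ball x \<rho>)"
      then have far: "\<And>x. x \<in> F \<Longrightarrow> \<rho> \<le> dist x z" by force
      then have "z \<notin> F" using \<rho> by force
      moreover have "P (insert z F)" using F far z by (auto simp: P_def dist_commute)
      ultimately show False using max[of "insert z F"] F by (auto simp: P_def)
    qed
  qed
  then show ?thesis using F by (auto simp: P_def)
qed

text \<open>The half-radius balls about a maximal separated set are disjoint and have mass at least
  \<open>a\<close>, so there are at most \<open>measure M K / a\<close> of them. The full balls
  cover \<open>Z\<close>, and each contains at most \<open>b\<close> of its mass.\<close>

lemma measure_le_of_local_bound:
  fixes M :: "'a::metric_space measure" and K :: "'a::metric_space set"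
  assumes M: "finite_measure M"
    and sp: "space M = K" and \<rho>: "0 < \<rho>"
    and balls: "\<And>x \<rho>. K \<inter> ball x \<rho> \<in> sets M"
    and a: "0 < a" "\<And>x. x \<in> K \<Longrightarrow> a \<le> measure M (K \<inter> ball x (\<rho> / 2))"
    and Z: "Z \<in> sets M" and b: "\<And>x. x \<in> K \<Longrightarrow> measure M (Z \<inter> ball x \<rho>) \<le> b"
  shows "a * measure M Z \<le> b * measure M K"
proof -
  interpret finite_measure M by (rule M)
  show ?thesis
  \<comment> \<open>For empty \<open>K\<close> the hypothesis on \<open>b\<close> is vacuous and
    \<open>b\<close> may be negative; otherwise any point of \<open>K\<close> shows
    \<open>0 \<le> b\<close>.\<close>
  proof (cases "K = {}")
    case True
    then have "Z = {}" using Z sp sets.sets_into_space by fastforce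
    then show ?thesis using True by simp
  next
    case False
    then obtain x0 where "x0 \<in> K" by blast
    then have b0: "0 \<le> b" using b[of x0] measure_nonneg[of M "Z \<inter> ball x0 \<rho>"] by linarith
    have ZK: "Z \<subseteq> K" using Z sp sets.sets_into_space by fastforce
    have card: "real (card F) * a \<le> measure M K"
      if F: "finite F" "F \<subseteq> K" "\<forall>x\<in>F. \<forall>y\<in>F. x \<noteq> y \<longrightarrow> \<rho> \<le> dist x y" for F
    proof -
      have "real (card F) * a \<le> (\<Sum>x\<in>F. measure M (K \<inter> ball x (\<rho> / 2)))"
        using F a by (intro sum_bounded_below) auto
      also have "\<dots> = measure M (\<Union>x\<in>F. K \<inter> ball x (\<rho> / 2))"
      proof (rule finite_measure_finite_Union[symmetric])
        show "disjoint_family_on (\<lambda>x. K \<inter> ball x (\<rho> / 2)) F"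
          unfolding disjoint_family_on_def
        proof (intro ballI impI)
          fix x y assume xy: "x \<in> F" "y \<in> F" "x \<noteq> y"
          have False if "dist x z < \<rho> / 2" "dist y z < \<rho> / 2" for z
            using F(3) xy that dist_triangle2[of x y z] by fastforce
          then show "K \<inter> ball x (\<rho> / 2) \<inter> (K \<inter> ball y (\<rho> / 2)) = {}" by auto
        qed
      qed (use F balls in auto)
      also have "\<dots> \<le> measure M K"
        using sp balls by (intro finite_measure_mono) auto
      finally show ?thesis .
    qed
    have cardle: "card F \<le> nat \<lceil>measure M K / a\<rceil>"
      if "finite F" "F \<subseteq> K" "\<forall>x\<in>F. \<forall>y\<in>F. x \<noteq> y \<longrightarrow> \<rho> \<le> dist x y" for F
    proof -
      have "real (card F) \<le> measure M K / a" using card[OF that] a(1) by (simp add: field_simps)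
      then show ?thesis by linarith
    qed
    have "\<exists>F. finite F \<and> F \<subseteq> K \<and> (\<forall>x\<in>F. \<forall>y\<in>F. x \<noteq> y \<longrightarrow> \<rho> \<le> dist x y) \<and>
        K \<subseteq> (\<Union>x\<in>F. ball x \<rho>)"
      by (rule exists_maximal_separated_set[OF \<rho> cardle])
    then obtain F where F: "finite F" "F \<subseteq> K" "\<forall>x\<in>F. \<forall>y\<in>F. x \<noteq> y \<longrightarrow> \<rho> \<le> dist x y"
      and cov: "K \<subseteq> (\<Union>x\<in>F. ball x \<rho>)"
      by (elim exE conjE)
    have Zb: "Z \<inter> ball x \<rho> \<in> sets M" for x
    proof -
      have "Z \<inter> ball x \<rho> = Z \<inter> (K \<inter> ball x \<rho>)" using ZK by auto
      then show ?thesis using Z balls by auto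
    qed
    have "measure M Z \<le> measure M (\<Union>x\<in>F. Z \<inter> ball x \<rho>)"
      using cov ZK Zb F(1) by (intro finite_measure_mono sets.finite_UN) auto
    also have "\<dots> \<le> (\<Sum>x\<in>F. measure M (Z \<inter> ball x \<rho>))"
      using Zb F(1) by (intro finite_measure_subadditive_finite) auto
    also have "\<dots> \<le> real (card F) * b"
      using b F by (intro sum_bounded_above) auto
    finally have "a * measure M Z \<le> a * (real (card F) * b)"
      using a(1) by simp
    also have "\<dots> = b * (real (card F) * a)" by simp
    also have "\<dots> \<le> b * measure M K"
      by (intro mult_left_mono card F b0)
    finally show ?thesis .
  qed
qed

section \<open>The energy cost of a jump between two levels\<close>

text \<open>Only pairs in \<open>X\<close> times \<open>Y\<close> are counted; on them both the
  squared difference and the kernel are bounded below by constants.\<close>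

lemma besov_energy_ge:
  fixes u :: "'a::metric_space \<Rightarrow> real"
  assumes X: "X \<in> sets \<nu>" and Y: "Y \<in> sets \<nu>" and st: "s < t" and \<gamma>: "0 \<le> \<gamma>"
    and u: "\<And>x. x \<in> X \<Longrightarrow> u x \<le> s" "\<And>y. y \<in> Y \<Longrightarrow> t \<le> u y"
    and d: "\<And>x y. x \<in> X \<Longrightarrow> y \<in> Y \<Longrightarrow> dist x y \<le> R"
  shows "ennreal ((t - s)\<^sup>2 * R powr (- \<gamma>)) * (emeasure \<nu> X * emeasure \<nu> Y)
    \<le> (\<integral>\<^sup>+ x. \<integral>\<^sup>+ y. ennreal ((u x - u y)\<^sup>2 * dist x y powr (- \<gamma>)) \<partial>\<nu> \<partial>\<nu>)"
proof -
  define k where "k = (t - s)\<^sup>2 * R powr (- \<gamma>)"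
  have k: "ennreal k * indicator X x * indicator Y y
      \<le> ennreal ((u x - u y)\<^sup>2 * dist x y powr (- \<gamma>))" for x y
  proof (cases "x \<in> X \<and> y \<in> Y")
    case True
    then have l: "t - s \<le> u y - u x" using u[of x] u(2)[of y] by auto
    \<comment> \<open>This matters because \<open>0 powr (- \<gamma>)\<close> is 0: on the diagonal
      the lower bound for the kernel would fail.\<close>
    then have "x \<noteq> y" using st by auto
    then have "R powr (- \<gamma>) \<le> dist x y powr (- \<gamma>)"
      using \<gamma> d True by (intro powr_mono2') auto
    moreover have "(t - s)\<^sup>2 \<le> (u x - u y)\<^sup>2"
      using l st by (subst power2_commute[of "u x"]) (intro power_mono, auto)
    ultimately have "k \<le> (u x - u y)\<^sup>2 * dist x y powr (- \<gamma>)"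
      unfolding k_def by (intro mult_mono) auto
    then show ?thesis using True by (simp add: ennreal_leI)
  qed auto
  have "ennreal k * (emeasure \<nu> X * emeasure \<nu> Y)
      = (\<integral>\<^sup>+ x. \<integral>\<^sup>+ y. ennreal k * indicator X x * indicator Y y \<partial>\<nu> \<partial>\<nu>)"
    using X Y by (simp add: nn_integral_cmult nn_integral_multc mult.assoc)
  also have "\<dots> \<le> (\<integral>\<^sup>+ x. \<integral>\<^sup>+ y. ennreal ((u x - u y)\<^sup>2 * dist x y powr (- \<gamma>)) \<partial>\<nu> \<partial>\<nu>)"
    by (intro nn_integral_mono k)
  finally show ?thesis by (simp add: k_def)
qed

lemma besov_product_bound:
  fixes M :: "'a::metric_space measure" and u :: "'a::metric_space \<Rightarrow> real"
  assumes M: "finite_measure M"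
    and st: "s < t" and \<gamma>: "0 \<le> \<gamma>"
    and fin: "(\<integral>\<^sup>+ x. \<integral>\<^sup>+ y. ennreal ((u x - u y)\<^sup>2 * dist x y powr (- \<gamma>)) \<partial>M \<partial>M) < \<infinity>"
  shows "\<exists>C>0. \<forall>X\<in>sets M. \<forall>Y\<in>sets M. \<forall>R>0. (\<forall>x\<in>X. u x \<le> s) \<longrightarrow> (\<forall>y\<in>Y. t \<le> u y) \<longrightarrow>
    (\<forall>x\<in>X. \<forall>y\<in>Y. dist x y \<le> R) \<longrightarrow> measure M X * measure M Y \<le> C * R powr \<gamma>"
proof -
  interpret finite_measure M by (rule M)
  define E where "E = enn2real (\<integral>\<^sup>+ x. \<integral>\<^sup>+ y. ennreal ((u x - u y)\<^sup>2 * dist x y powr (- \<gamma>)) \<partial>M \<partial>M)"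
  have E: "(\<integral>\<^sup>+ x. \<integral>\<^sup>+ y. ennreal ((u x - u y)\<^sup>2 * dist x y powr (- \<gamma>)) \<partial>M \<partial>M) = ennreal E"
    and E0: "0 \<le> E" using fin by (simp_all add: E_def)
  have "measure M X * measure M Y \<le> (E + 1) / (t - s)\<^sup>2 * R powr \<gamma>"
    if "X \<in> sets M" "Y \<in> sets M" and R: "0 < R" and "\<forall>x\<in>X. u x \<le> s" "\<forall>y\<in>Y. t \<le> u y"
      "\<forall>x\<in>X. \<forall>y\<in>Y. dist x y \<le> R" for X Y R
  proof -
    have "ennreal ((t - s)\<^sup>2 * R powr (- \<gamma>)) * (emeasure M X * emeasure M Y) \<le> ennreal E"
      unfolding E[symmetric] using that st \<gamma> by (intro besov_energy_ge) auto
    then have "(t - s)\<^sup>2 * R powr (- \<gamma>) * (measure M X * measure M Y) \<le> E"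
      using E0 by (simp add: emeasure_eq_measure ennreal_mult[symmetric])
    \<comment> \<open>Passing to \<open>E + 1\<close> makes the constant positive even for zero
      energy.\<close>
    then have "(t - s)\<^sup>2 * R powr (- \<gamma>) * (measure M X * measure M Y) \<le> E + 1" by simp
    then show ?thesis
      using R st by (simp add: powr_minus field_simps)
  qed
  moreover have "0 < (E + 1) / (t - s)\<^sup>2" using E0 st by simp
  ultimately show ?thesis by (intro exI[of _ "(E + 1) / (t - s)\<^sup>2"]) simp
qed

text \<open>At a small scale \<open>\<rho>\<close> the energy cannot afford a ball in which both \<open>u \<le> s\<close> and \<open>u \<ge> t\<close> have
  measure of order \<open>\<rho> powr \<alpha>\<close>. Hence each ball has a dominant phase, and by connectedness it is the
  same one for all balls; summing the minority phase over a \<open>\<rho>\<close>-net gives \<open>O(\<rho> powr (\<beta> - \<alpha>))\<close>.\<close>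

lemma besov_no_gap:
  fixes M :: "'a::metric_space measure" and u :: "'a::metric_space \<Rightarrow> real"
  assumes M: "finite_measure M"
    and sp: "space M = K" and balls: "\<And>x \<rho>. K \<inter> ball x \<rho> \<in> sets M"
    and conn: "connected K" and u[measurable]: "u \<in> borel_measurable M"
    and \<alpha>: "0 < \<alpha>" "\<alpha> < \<beta>" and D: "0 < D" and c: "0 < c"
    and reg: "\<And>x \<rho>. x \<in> K \<Longrightarrow> 0 < \<rho> \<Longrightarrow> \<rho> \<le> D \<Longrightarrow> c * \<rho> powr \<alpha> \<le> measure M (K \<inter> ball x \<rho>)"
    and fin: "(\<integral>\<^sup>+ x. \<integral>\<^sup>+ y. ennreal ((u x - u y)\<^sup>2 * dist x y powr (- (\<alpha> + \<beta>))) \<partial>M \<partial>M) < \<infinity>"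
    and st: "s < t" and gap: "AE x in M. \<not> (s < u x \<and> u x < t)"
  shows "(AE x in M. s < u x) \<or> (AE x in M. u x < t)"
proof -
  interpret finite_measure M by (rule M)
  define A where "A = {x\<in>space M. u x \<le> s}"
  define B where "B = {x\<in>space M. t \<le> u x}"
  have AB[measurable]: "A \<in> sets M" "B \<in> sets M" unfolding A_def B_def by measurable
  obtain C where C: "0 < C" and prod: "\<And>X Y R. X \<in> sets M \<Longrightarrow> Y \<in> sets M \<Longrightarrow> 0 < R \<Longrightarrow> X \<subseteq> A \<Longrightarrow> Y \<subseteq> B \<Longrightarrow>
      (\<forall>x\<in>X. \<forall>y\<in>Y. dist x y \<le> R) \<Longrightarrow> measure M X * measure M Y \<le> C * R powr (\<alpha> + \<beta>)"
  proof -
    obtain C where C: "0 < C" and *: "\<And>X Y R. X \<in> sets M \<Longrightarrow> Y \<in> sets M \<Longrightarrow> 0 < R \<Longrightarrow>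
        (\<forall>x\<in>X. u x \<le> s) \<Longrightarrow> (\<forall>y\<in>Y. t \<le> u y) \<Longrightarrow> (\<forall>x\<in>X. \<forall>y\<in>Y. dist x y \<le> R) \<Longrightarrow>
        measure M X * measure M Y \<le> C * R powr (\<alpha> + \<beta>)"
      using besov_product_bound[OF M st _ fin] \<alpha> by auto
    show ?thesis by (rule that[OF C *]) (auto simp: A_def B_def)
  qed
  have sub: "Z \<inter> ball x \<rho> \<in> sets M" if "Z \<in> sets M" for Z x \<rho>
  proof -
    have "Z \<inter> ball x \<rho> = Z \<inter> (K \<inter> ball x \<rho>)" using sets.sets_into_space[OF that] sp by auto
    then show ?thesis using that balls by auto
  qed
  \<comment> \<open>By \<open>gap\<close>, the disjoint sets \<open>A\<close> and \<open>B\<close>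
    exhaust \<open>K\<close> up to a null set.\<close>
  have split: "measure M (K \<inter> ball x \<rho>) = measure M (A \<inter> ball x \<rho>) + measure M (B \<inter> ball x \<rho>)" for x \<rho>
  proof -
    have "measure M (K \<inter> ball x \<rho>) = measure M ((A \<inter> ball x \<rho>) \<union> (B \<inter> ball x \<rho>))"
    proof (rule finite_measure_eq_AE)
      show "AE y in M. (y \<in> K \<inter> ball x \<rho>) = (y \<in> A \<inter> ball x \<rho> \<union> B \<inter> ball x \<rho>)"
        using gap AE_space by eventually_elim (use sp in \<open>auto simp: A_def B_def\<close>)
    qed (use sub balls in auto)
    also have "\<dots> = measure M (A \<inter> ball x \<rho>) + measure M (B \<inter> ball x \<rho>)"
      using sub st by (intro finite_measure_Union) (auto simp: A_def B_def)
    finally show ?thesis .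
  qed
  \<comment> \<open>The 3 comes from two balls of radius \<open>\<rho>\<close> whose centres are
    closer than \<open>\<rho>\<close>: their points are at most \<open>3 * \<rho>\<close>
    apart.\<close>
  define L where "L = C * 3 powr (\<alpha> + \<beta>)"
  have L: "0 < L" using C by (simp add: L_def)
  define Q where "Q = 2 * L * 2 powr \<alpha> * measure M K / c\<^sup>2"
  have scale: "min (measure M A) (measure M B) \<le> Q * \<rho> powr (\<beta> - \<alpha>)"
    if \<rho>: "0 < \<rho>" "\<rho> \<le> D" and small: "L * \<rho> powr (\<beta> - \<alpha>) < (c / 2)\<^sup>2" for \<rho>
  proof -
    \<comment> \<open>Half of the guaranteed mass of a ball, so in each ball one of \<open>A\<close>
      and \<open>B\<close> has mass at least \<open>h\<close>. By \<open>small\<close>, the energy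
      bound for two neighbouring balls is below \<open>h * h\<close>, so \<open>A\<close> in one and
      \<open>B\<close> in the other cannot both reach \<open>h\<close>.\<close>
    define h where "h = c * \<rho> powr \<alpha> / 2"
    have h: "0 < h" using c \<rho> by (simp add: h_def)
    have "\<rho> powr (\<alpha> + \<beta>) = \<rho> powr (\<beta> - \<alpha>) * (\<rho> powr \<alpha>)\<^sup>2"
      using \<rho> by (simp add: power2_eq_square flip: powr_add)
    then have Lr: "C * (3 * \<rho>) powr (\<alpha> + \<beta>) = L * \<rho> powr (\<beta> - \<alpha>) * (\<rho> powr \<alpha>)\<^sup>2"
      using \<rho> by (simp add: L_def powr_mult)
    also have "\<dots> < (c / 2)\<^sup>2 * (\<rho> powr \<alpha>)\<^sup>2"
      using \<rho> small by (intro mult_strict_right_mono) auto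
    also have "\<dots> = h * h" by (simp add: h_def power2_eq_square)
    finally have less: "C * (3 * \<rho>) powr (\<alpha> + \<beta>) < h * h" .
    have prod3: "measure M (A \<inter> ball x \<rho>) * measure M (B \<inter> ball y \<rho>) \<le> C * (3 * \<rho>) powr (\<alpha> + \<beta>)"
      if "dist x y < \<rho>" for x y
    proof (rule prod)
      have "dist a b \<le> 3 * \<rho>" if "dist x a < \<rho>" "dist y b < \<rho>" for a b
        using that \<open>dist x y < \<rho>\<close> dist_triangle[of a b x] dist_triangle[of x b y]
        by (simp add: dist_commute)
      then show "\<forall>a\<in>A \<inter> ball x \<rho>. \<forall>b\<in>B \<inter> ball y \<rho>. dist a b \<le> 3 * \<rho>" by auto
    qed (use \<rho> sub in auto)
    define P where "P x \<longleftrightarrow> h \<le> measure M (A \<inter> ball x \<rho>)" for x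
    have notP: "h \<le> measure M (B \<inter> ball x \<rho>)" if "x \<in> K" "\<not> P x" for x
      using reg[OF that(1) \<rho>] that(2) split[of x \<rho>] by (simp add: P_def h_def)
    have near: "P y" if "P x" "y \<in> K" "dist x y < \<rho>" for x y
    proof (rule ccontr)
      assume "\<not> P y"
      then have "h * h \<le> measure M (A \<inter> ball x \<rho>) * measure M (B \<inter> ball y \<rho>)"
        using notP that h by (intro mult_mono) (auto simp: P_def)
      then show False using prod3[OF that(3)] less by simp
    qed
    \<comment> \<open>Points of \<open>K\<close> in a common ball of radius
      \<open>\<rho> / 2\<close> are closer than \<open>\<rho>\<close>, so \<open>near\<close> makes
      \<open>P\<close> locally constant on \<open>K\<close>.\<close>
    have all: "P y" if "P x" "x \<in> K" "y \<in> K" for x y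
    proof (rule connected_induction_simple[where P = P, OF conn that(2,3,1)])
      fix a assume "a \<in> K"
      have "\<forall>y\<in>K \<inter> ball a (\<rho> / 2). \<forall>z\<in>K \<inter> ball a (\<rho> / 2). P y \<longrightarrow> P z"
      proof (intro ballI impI)
        fix y z assume "y \<in> K \<inter> ball a (\<rho> / 2)" "z \<in> K \<inter> ball a (\<rho> / 2)" "P y"
        then show "P z" using dist_triangle_half_r[of a y \<rho> z] near[of y z] by simp
      qed
      moreover have "openin (top_of_set K) (K \<inter> ball a (\<rho> / 2))"
        by (intro openin_open_Int open_ball)
      moreover have "a \<in> K \<inter> ball a (\<rho> / 2)" using \<open>a \<in> K\<close> \<rho> by simp
      ultimately show "\<exists>T. openin (top_of_set K) T \<and> a \<in> T \<and> (\<forall>x\<in>T. \<forall>y\<in>T. P x \<longrightarrow> P y)" by (intro exI[of _ "K \<inter> ball a (\<rho> / 2)"] conjI)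
    qed
    \<comment> \<open>The solution of
      \<open>h * b = C * (3 * \<rho>) powr (\<alpha> + \<beta>)\<close>: it bounds the minority mass
      in a ball whose majority mass is at least \<open>h\<close>.\<close>
    define b where "b = 2 * L / c * \<rho> powr (\<beta> - \<alpha>) * \<rho> powr \<alpha>"
    have hb: "h * b = C * (3 * \<rho>) powr (\<alpha> + \<beta>)"
    proof -
      have "c * e / 2 * (2 * L / c * a * e) = L * a * e\<^sup>2" for a e
        using c by (simp add: field_simps power2_eq_square)
      then show ?thesis unfolding Lr h_def b_def .
    qed
    have concl: "measure M Z \<le> Q * \<rho> powr (\<beta> - \<alpha>)"
      if Z: "Z \<in> sets M" and "\<And>x. x \<in> K \<Longrightarrow> h * measure M (Z \<inter> ball x \<rho>) \<le> h * b" for Z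
    proof -
      have "c * (\<rho> / 2) powr \<alpha> * measure M Z \<le> b * measure M K"
      proof (rule measure_le_of_local_bound[OF M sp \<rho>(1) balls _ _ Z])
        show "measure M (Z \<inter> ball x \<rho>) \<le> b" if "x \<in> K" for x
          using \<open>\<And>x. x \<in> K \<Longrightarrow> h * measure M (Z \<inter> ball x \<rho>) \<le> h * b\<close>[OF that] h by simp
      qed (use c \<rho> reg in auto)
      also have "\<dots> = c * (\<rho> / 2) powr \<alpha> * (Q * \<rho> powr (\<beta> - \<alpha>))"
      proof -
        have "2 * L / c * a * e * k = c * (e / w) * (2 * L * w * k / c\<^sup>2 * a)" if "0 < w" for a e k w
          using c that by (simp add: field_simps power2_eq_square)
        then show ?thesis using \<rho> by (simp add: b_def Q_def powr_divide)
      qed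
      finally show ?thesis using c \<rho> by simp
    qed
    show ?thesis
    proof (cases "\<exists>x\<in>K. P x")
      case True
      then have hA: "h \<le> measure M (A \<inter> ball x \<rho>)" if "x \<in> K" for x
        using all that by (auto simp: P_def)
      have "h * measure M (B \<inter> ball x \<rho>) \<le> h * b" if "x \<in> K" for x
      proof -
        have "h * measure M (B \<inter> ball x \<rho>) \<le> measure M (A \<inter> ball x \<rho>) * measure M (B \<inter> ball x \<rho>)"
          using hA that by (intro mult_right_mono) auto
        then show ?thesis using prod3[of x x] \<rho> hb by simp
      qed
      then have "measure M B \<le> Q * \<rho> powr (\<beta> - \<alpha>)" by (rule concl[OF AB(2)])
      then show ?thesis by simp
    next
      case False
      have "h * measure M (A \<inter> ball x \<rho>) \<le> h * b" if "x \<in> K" for x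
      proof -
        have "measure M (A \<inter> ball x \<rho>) * h \<le> measure M (A \<inter> ball x \<rho>) * measure M (B \<inter> ball x \<rho>)"
          using notP that False by (intro mult_left_mono) auto
        then show ?thesis using prod3[of x x] \<rho> hb by (simp add: mult.commute)
      qed
      then have "measure M A \<le> Q * \<rho> powr (\<beta> - \<alpha>)" by (rule concl[OF AB(1)])
      then show ?thesis by simp
    qed
  qed
  have lim: "((\<lambda>\<rho>. z * \<rho> powr (\<beta> - \<alpha>)) \<longlongrightarrow> 0) (at_right 0)" for z
  proof -
    have "((\<lambda>\<rho>. z * \<rho> powr (\<beta> - \<alpha>)) \<longlongrightarrow> z * 0 powr (\<beta> - \<alpha>)) (at_right 0)"
      using \<alpha> by (intro tendsto_intros tendsto_powr') (auto intro: eventually_at_right_less eventually_mono)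
    then show ?thesis by simp
  qed
  have "\<forall>\<^sub>F \<rho> in at_right 0. L * \<rho> powr (\<beta> - \<alpha>) < (c / 2)\<^sup>2"
    using c by (intro order_tendstoD(2)[OF lim]) auto
  moreover have "\<forall>\<^sub>F \<rho> in at_right 0. 0 < \<rho> \<and> \<rho> \<le> D"
    using eventually_at_right_less eventually_at_right_real[OF D] by eventually_elim auto
  ultimately have "\<forall>\<^sub>F \<rho> in at_right 0. min (measure M A) (measure M B) \<le> Q * \<rho> powr (\<beta> - \<alpha>)"
    by eventually_elim (use scale in auto)
  \<comment> \<open>The left side does not depend on \<open>\<rho>\<close>, while the right side
    tends to 0 because \<open>\<alpha> < \<beta>\<close>.\<close>
  then have "min (measure M A) (measure M B) \<le> 0"
    by (rule tendsto_lowerbound[OF lim]) simp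
  then have "measure M A = 0 \<or> measure M B = 0"
    using measure_nonneg[of M A] measure_nonneg[of M B] by linarith
  then have "A \<in> null_sets M \<or> B \<in> null_sets M"
    by (auto simp: null_sets_def emeasure_eq_measure)
  then show ?thesis
  proof
    assume "A \<in> null_sets M"
    then have "AE x in M. s < u x"
      using AE_not_in[of A M] AE_space by (auto simp: A_def elim: eventually_elim2)
    then show ?thesis ..
  next
    assume "B \<in> null_sets M"
    then have "AE x in M. u x < t"
      using AE_not_in[of B M] AE_space by (auto simp: B_def elim: eventually_elim2)
    then show ?thesis ..
  qed
qed

section \<open>The essential range and composition with tent functions\<close>

text \<open>Otherwise each pair \<open>s < t\<close> has a one-sided bound. Then the essential
  infimum, the supremum of the set \<open>T\<close> of strict lower bounds, is also an upper bound
  almost everywhere, so \<open>u\<close> is constant.\<close>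

lemma ae_nonconstant_imp_separated_values:
  fixes u :: "'a \<Rightarrow> real"
  assumes "\<forall>c. \<not> (AE x in M. u x = c)"
  shows "\<exists>s t. s < t \<and> \<not> (AE x in M. s < u x) \<and> \<not> (AE x in M. u x < t)"
proof (rule ccontr)
  assume "\<not> ?thesis"
  then have dich: "(AE x in M. s < u x) \<or> (AE x in M. u x < t)" if "s < t" for s t
    using that by blast
  define T where "T = {s. AE x in M. s < u x}"
  have "T \<noteq> {}"
  proof
    assume "T = {}"
    then have "AE x in M. u x < - real n" for n
      using dich[of "- real n - 1" "- real n"] by (auto simp: T_def)
    then have "AE x in M. \<forall>n. u x < - real n" by (simp add: AE_all_countable)
    \<comment> \<open>No real number lies below every \<open>- real n\<close>, so the measure is
      null and \<open>u\<close> agrees almost everywhere with any constant, such as 0.\<close>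
    then have "AE x in M. u x = 0"
    proof eventually_elim
      case (elim x)
      obtain n where "- u x < real n" using reals_Archimedean2 by blast
      then show ?case using elim[rule_format, of n] by simp
    qed
    then show False using assms by blast
  qed
  moreover have "bdd_above T"
  proof (rule ccontr)
    assume "\<not> bdd_above T"
    then have unbdd: "\<exists>s\<in>T. \<not> s \<le> real n" for n
      unfolding bdd_above_def by blast
    have "AE x in M. real n < u x" for n
    proof -
      obtain z where "z \<in> T" "\<not> z \<le> real n" using unbdd by blast
      then show ?thesis by (auto simp: T_def elim!: eventually_mono)
    qed
    then have "AE x in M. \<forall>n. real n < u x" by (simp add: AE_all_countable)
    then have "AE x in M. u x = 0"
    proof eventually_elim
      case (elim x)
      obtain n where "u x < real n" using reals_Archimedean2 by blast
      then show ?case using elim[rule_format, of n] by simp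
    qed
    then show False using assms by blast
  qed
  ultimately have lower: "\<exists>s\<in>T. z < s" if "z < Sup T" for z
    using that less_cSup_iff by blast
  define c where "c = Sup T"
  have "AE x in M. c - inverse (Suc n) < u x \<and> u x < c + inverse (Suc n)" for n
  proof -
    have pos: "0 < inverse (real (Suc n))" by simp
    obtain s where "s \<in> T" "c - inverse (Suc n) < s"
      using lower[of "c - inverse (Suc n)"] pos unfolding c_def by auto
    then have "AE x in M. c - inverse (Suc n) < u x"
      by (auto simp: T_def elim: eventually_mono)
    \<comment> \<open>The half step lies above the supremum, hence outside \<open>T\<close>, and
      still below the target level, so the dichotomy leaves only the upper bound.\<close>
    moreover have "c + inverse (Suc n) / 2 \<notin> T"
      using cSup_upper[OF _ \<open>bdd_above T\<close>, of "c + inverse (Suc n) / 2"] pos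
      by (auto simp: c_def)
    then have "AE x in M. u x < c + inverse (Suc n)"
      using dich[of "c + inverse (Suc n) / 2" "c + inverse (Suc n)"] pos by (simp add: T_def)
    ultimately show ?thesis by eventually_elim auto
  qed
  then have "AE x in M. \<forall>n. c - inverse (Suc n) < u x \<and> u x < c + inverse (Suc n)"
    by (simp add: AE_all_countable)
  then have "AE x in M. u x = c"
  proof eventually_elim
    case (elim x)
    show ?case
    proof (rule ccontr)
      assume "u x \<noteq> c"
      then obtain n where "inverse (real (Suc n)) < \<bar>u x - c\<bar>"
        using reals_Archimedean[of "\<bar>u x - c\<bar>"] by auto
      then show False using elim[rule_format, of n] by (auto simp: abs_if split: if_splits)
    qed
  qed
  then show False using assms by blast
qed

text \<open>A contraction decreases the energy integrand pointwise. Boundedness gives square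
  integrability because the measure is finite.\<close>

lemma besov_space_comp:
  fixes M :: "'a::metric_space measure" and u :: "'a::metric_space \<Rightarrow> real" and \<phi> :: "real \<Rightarrow> real"
  assumes M: "finite_measure M"
    and u: "u \<in> besov_space M \<alpha> \<beta>" and lip: "\<And>v w. \<bar>\<phi> v - \<phi> w\<bar> \<le> \<bar>v - w\<bar>"
    and bdd: "\<And>v. \<bar>\<phi> v\<bar> \<le> h"
  shows "(\<lambda>x. \<phi> (u x)) \<in> besov_space M \<alpha> \<beta>"
proof -
  interpret finite_measure M by (rule M)
  have um[measurable]: "u \<in> borel_measurable M" using u by (simp add: besov_space_def)
  have "1-lipschitz_on UNIV \<phi>" using lip by (auto intro!: lipschitz_onI simp: dist_real_def)
  then have [measurable]: "\<phi> \<in> borel_measurable borel"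
    by (intro borel_measurable_continuous_onI lipschitz_on_continuous_on)
  have "integrable M (\<lambda>x. (\<phi> (u x))\<^sup>2)"
  proof (rule integrable_const_bound[where B = "h\<^sup>2"])
    show "AE x in M. norm ((\<phi> (u x))\<^sup>2) \<le> h\<^sup>2"
      using bdd by (intro AE_I2) (simp add: abs_le_square_iff[symmetric] order_trans[OF bdd abs_ge_self])
  qed simp
  moreover have "(\<integral>\<^sup>+ x. \<integral>\<^sup>+ y. ennreal ((\<phi> (u x) - \<phi> (u y))\<^sup>2 * dist x y powr (- (\<alpha> + \<beta>))) \<partial>M \<partial>M)
    \<le> (\<integral>\<^sup>+ x. \<integral>\<^sup>+ y. ennreal ((u x - u y)\<^sup>2 * dist x y powr (- (\<alpha> + \<beta>))) \<partial>M \<partial>M)"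
    using lip by (intro nn_integral_mono ennreal_leI mult_right_mono) (auto simp: abs_le_square_iff)
  ultimately show ?thesis
    using u by (auto simp: besov_space_def intro: le_less_trans)
qed

text \<open>On the set where \<open>u\<close> lies in one open subinterval only one tent is nonzero.
  By \<open>dense\<close> this set is not null, so a vanishing combination has zero coefficient
  there.\<close>

lemma besov_space_infinite_dimensional:
  fixes M :: "'a::metric_space measure" and u :: "'a::metric_space \<Rightarrow> real"
  assumes M: "finite_measure M"
    and u: "u \<in> besov_space M \<alpha> \<beta>" and st: "s < t"
    and dense: "\<And>p q. s \<le> p \<Longrightarrow> p < q \<Longrightarrow> q \<le> t \<Longrightarrow> \<not> (AE x in M. \<not> (p < u x \<and> u x < q))"
  shows "ae_infinite_dimensional M (besov_space M \<alpha> \<beta>)"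
  unfolding ae_infinite_dimensional_def
proof
  fix n :: nat
  \<comment> \<open>The interval from \<open>s\<close> to \<open>t\<close> is cut into
    \<open>n\<close> pieces of half-length \<open>h\<close> with midpoints \<open>m k\<close>. The
    tents have slope 1, hence height \<open>h\<close>. For \<open>n = 0\<close> division by zero
    gives \<open>h = 0\<close>, so positivity is claimed only in the presence of some
    \<open>k < n\<close>.\<close>
  define h where "h = (t - s) / (2 * real n)"
  define m where "m k = s + (2 * real k + 1) * h" for k :: nat
  define \<phi> where "\<phi> k v = max 0 (h - \<bar>v - m k\<bar>)" for k v
  have h: "0 < h" if "k < n" for k using that st by (simp add: h_def)
  have sep: "2 * h \<le> \<bar>m i - m j\<bar>" if "i < n" "i \<noteq> j" for i j
  proof -
    have "m i - m j = 2 * h * (real i - real j)" by (simp add: m_def algebra_simps)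
    then have "\<bar>m i - m j\<bar> = 2 * h * \<bar>real i - real j\<bar>" using h[OF that(1)] by (simp add: abs_mult)
    moreover have "1 \<le> \<bar>real i - real j\<bar>" using that(2) by linarith
    ultimately show ?thesis using h[OF that(1)] by simp
  qed
  have "(\<lambda>x. \<phi> k (u x)) \<in> besov_space M \<alpha> \<beta>" if "k < n" for k
    using h[OF that] by (intro besov_space_comp[OF M u, where h = h]) (auto simp: \<phi>_def)
  moreover have "c j = 0" if ae: "AE x in M. (\<Sum>i<n. c i * \<phi> i (u x)) = 0" and j: "j < n" for c j
  proof (rule ccontr)
    assume cj: "c j \<noteq> 0"
    have "AE x in M. \<not> (m j - h < u x \<and> u x < m j + h)"
      using ae
    proof eventually_elim
      case (elim x)
      show ?case
      proof
        assume x: "m j - h < u x \<and> u x < m j + h"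
        have "\<phi> i (u x) = 0" if "i < n" "i \<noteq> j" for i
          using sep[OF that] x by (auto simp: \<phi>_def abs_if split: if_splits)
        then have "(\<Sum>i<n. c i * \<phi> i (u x)) = (\<Sum>i<n. if i = j then c j * \<phi> j (u x) else 0)"
          by (intro sum.cong) auto
        also have "\<dots> = c j * \<phi> j (u x)" using j by simp
        finally show False using elim cj x by (auto simp: \<phi>_def abs_if split: if_splits)
      qed
    qed
    moreover have "m j + h \<le> t"
    proof -
      have "m j + h = s + (2 * (real j + 1)) * h" by (simp add: m_def algebra_simps)
      also have "\<dots> \<le> s + (2 * real n) * h" using h[OF j] j by (intro add_left_mono mult_right_mono) auto
      also have "\<dots> = t" using j by (simp add: h_def)
      finally show ?thesis .
    qed
    moreover have "s \<le> m j - h" using h[OF j] by (simp add: m_def algebra_simps)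
    ultimately show False using dense[of "m j - h" "m j + h"] h[OF j] by simp
  qed
  ultimately show "\<exists>u. (\<forall>i<n. u i \<in> besov_space M \<alpha> \<beta>) \<and>
      (\<forall>c. (AE x in M. (\<Sum>i<n. c i * u i x) = 0) \<longrightarrow> (\<forall>i<n. c i = 0))"
    by (intro exI[of _ "\<lambda>k x. \<phi> k (u x)"]) blast
qed

section \<open>Nonconstancy, infinite dimension and the critical exponents\<close>

text \<open>Two constants \<open>a\<close> and \<open>b\<close> are dependent through the
  coefficients \<open>b\<close> and \<open>- a\<close>. Independence would make both constants 0,
  and then every combination vanishes.\<close>

lemma ae_infinite_dimensional_imp_nonconstant:
  assumes "ae_infinite_dimensional M D"
  shows "ae_has_nonconstant M D"
proof (rule ccontr)
  assume "\<not> ?thesis"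
  then have const: "\<exists>c. AE x in M. u x = c" if "u \<in> D" for u
    using that by (auto simp: ae_has_nonconstant_def)
  obtain u :: "nat \<Rightarrow> 'a \<Rightarrow> real" where u: "\<And>i. i < 2 \<Longrightarrow> u i \<in> D"
    and ind: "\<And>c. (AE x in M. (\<Sum>i<2. c i * u i x) = 0) \<Longrightarrow> (\<forall>i<2::nat. c i = 0)"
    using assms unfolding ae_infinite_dimensional_def by blast
  obtain a where a: "AE x in M. u 0 x = a" using const[OF u, of 0] by auto
  obtain b where b: "AE x in M. u 1 x = b" using const[OF u, of 1] by auto
  have ab: "b = 0 \<and> - a = 0"
  proof -
    have "AE x in M. (\<Sum>i<2. (if i = 0 then b else - a) * u i x) = 0"
      using a b by eventually_elim (simp add: numeral_2_eq_2)
    from ind[OF this] show ?thesis by (metis one_less_numeral_iff semiring_norm(76) pos2 zero_neq_one)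
  qed
  have "AE x in M. (\<Sum>i<2. 1 * u i x) = 0"
    using a b by eventually_elim (use ab in \<open>simp add: numeral_2_eq_2\<close>)
  from ind[OF this] show False by (metis pos2 zero_neq_one)
qed

text \<open>Since \<open>measure_of\<close> yields the null measure when its argument is not a measure, and division by
  \<open>0\<close> or \<open>\<infinity>\<close> yields \<open>0\<close> here as well, a nonzero total mass already certifies that the Hausdorff
  measure is a measure on \<open>K\<close> and is positive and finite there.\<close>

lemma normalized_hausdorff_nonzero:
  assumes "emeasure (normalized_hausdorff s K) K \<noteq> 0" and K: "K \<in> sets borel"
  shows "hausdorff_outer s K \<noteq> 0" "hausdorff_outer s K \<noteq> \<infinity>"
    "\<And>A. A \<in> sets (restrict_space borel K) \<Longrightarrow>
       emeasure (normalized_hausdorff s K) A = hausdorff_outer s A / hausdorff_outer s K"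
proof -
  have sub: "sets (restrict_space borel K) \<subseteq> Pow K"
    using sets.space_closed[of "restrict_space borel K"] by (simp add: space_restrict_space)
  have *: "measure_space K (sigma_sets K (sets (restrict_space borel K)))
      (\<lambda>A. hausdorff_outer s A / hausdorff_outer s K)"
    and ne: "hausdorff_outer s K / hausdorff_outer s K \<noteq> 0"
    using assms(1) sub
    by (auto simp: normalized_hausdorff_def emeasure_measure_of_conv split: if_splits)
  show "hausdorff_outer s K \<noteq> 0" "hausdorff_outer s K \<noteq> \<infinity>"
    using ne by auto
  show "emeasure (normalized_hausdorff s K) A = hausdorff_outer s A / hausdorff_outer s K"
    if "A \<in> sets (restrict_space borel K)" for A
    using that * sub by (auto simp: normalized_hausdorff_def emeasure_measure_of_conv)
qed

lemma space_normalized_hausdorff: "space (normalized_hausdorff s K) = K"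
  and sets_normalized_hausdorff: "sets (normalized_hausdorff s K) = sets (restrict_space borel K)"
proof -
  have sub: "sets (restrict_space borel K) \<subseteq> Pow K"
    using sets.space_closed[of "restrict_space borel K"] by (simp add: space_restrict_space)
  then show "space (normalized_hausdorff s K) = K" by (simp add: normalized_hausdorff_def space_measure_of)
  show "sets (normalized_hausdorff s K) = sets (restrict_space borel K)"
    using sub sets.sigma_sets_eq[of "restrict_space borel K"]
    by (simp add: normalized_hausdorff_def sets_measure_of space_restrict_space)
qed

text \<open>A gap of the essential range between the levels \<open>s\<close> and \<open>t\<close>
  would put \<open>u\<close> almost everywhere on one side of it, against the choice of these
  levels. So every subinterval is charged, as the tent construction requires.\<close>

lemma besov_space_nonconstant_imp_infinite_dimensional:
  fixes S :: "nat \<Rightarrow> 'a::metric_space \<Rightarrow> 'a"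
  assumes S: "\<forall>i<N. 0 < r i \<and> r i < 1 \<and> similitude (S i) (r i)"
    and K: "self_similar_set N S K" and conn: "connected K" and \<alpha>: "0 < \<alpha>" "\<alpha> < \<beta>"
    and nc: "ae_has_nonconstant (normalized_hausdorff \<alpha> K) (besov_space (normalized_hausdorff \<alpha> K) \<alpha> \<beta>)"
  shows "ae_infinite_dimensional (normalized_hausdorff \<alpha> K) (besov_space (normalized_hausdorff \<alpha> K) \<alpha> \<beta>)"
proof -
  define \<nu> where "\<nu> = normalized_hausdorff \<alpha> K"
  define H where "H = hausdorff_outer \<alpha> K"
  have sp: "space \<nu> = K" and sets: "sets \<nu> = sets (restrict_space borel K)"
    by (simp_all add: \<nu>_def space_normalized_hausdorff sets_normalized_hausdorff)
  have Kb: "K \<in> sets borel" using K by (auto simp: self_similar_set_def intro: borel_compact)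
  have balls: "K \<inter> ball x \<rho> \<in> sets \<nu>" for x \<rho>
    using Kb by (auto simp: sets sets_restrict_space)
  obtain u where u: "u \<in> besov_space \<nu> \<alpha> \<beta>" and ncu: "\<forall>c. \<not> (AE x in \<nu>. u x = c)"
    using nc unfolding ae_has_nonconstant_def \<nu>_def by blast
  \<comment> \<open>Under a null measure every function is almost everywhere constant, so
    nonconstancy of \<open>u\<close> is what yields positive finite Hausdorff measure of
    \<open>K\<close>.\<close>
  have "emeasure \<nu> K \<noteq> 0"
  proof
    assume "emeasure \<nu> K = 0"
    then have "AE x in \<nu>. u x = 0" using sp by (intro AE_I[of _ _ K]) (auto intro: sets.top)
    then show False using ncu by blast
  qed
  note nz = normalized_hausdorff_nonzero[OF this[unfolded \<nu>_def] Kb, folded \<nu>_def H_def]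
  have "K \<in> sets \<nu>" using sp sets.top by blast
  then have "emeasure \<nu> K = H / H" using nz(3) by (simp add: sets H_def)
  then have "emeasure \<nu> (space \<nu>) = 1" using nz(1,2) sp by (simp add: ennreal_divide_self less_top)
  then interpret prob_space \<nu> by (rule prob_spaceI)
  obtain c D where c: "0 < c" and D: "0 < D" and reg: "\<And>x \<rho>. x \<in> K \<Longrightarrow> 0 < \<rho> \<Longrightarrow> \<rho> \<le> D \<Longrightarrow>
      ennreal (c * \<rho> powr \<alpha>) * H \<le> hausdorff_outer \<alpha> (K \<inter> ball x \<rho>)"
    using hausdorff_outer_ball_ge[OF S K, of \<alpha>] \<alpha> unfolding H_def by auto
  have reg': "c * \<rho> powr \<alpha> \<le> measure \<nu> (K \<inter> ball x \<rho>)" if "x \<in> K" "0 < \<rho>" "\<rho> \<le> D" for x \<rho>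
  proof -
    have "ennreal (c * \<rho> powr \<alpha>) = ennreal (c * \<rho> powr \<alpha>) * H / H"
      using nz(1,2) by (simp add: ennreal_mult_divide_eq)
    also have "\<dots> \<le> hausdorff_outer \<alpha> (K \<inter> ball x \<rho>) / H"
      by (intro divide_right_mono_ennreal reg that)
    also have "\<dots> = emeasure \<nu> (K \<inter> ball x \<rho>)"
      using nz(3) balls by (simp add: sets)
    finally show ?thesis by (simp add: emeasure_eq_measure)
  qed
  obtain s t where st: "s < t" and s: "\<not> (AE x in \<nu>. s < u x)" and t: "\<not> (AE x in \<nu>. u x < t)"
    using ae_nonconstant_imp_separated_values[OF ncu] by blast
  have "ae_infinite_dimensional \<nu> (besov_space \<nu> \<alpha> \<beta>)"
  proof (rule besov_space_infinite_dimensional[OF finite_measure_axioms u st])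
    fix p q assume pq: "s \<le> p" "p < q" "q \<le> t"
    show "\<not> (AE x in \<nu>. \<not> (p < u x \<and> u x < q))"
    proof
      assume "AE x in \<nu>. \<not> (p < u x \<and> u x < q)"
      then have "(AE x in \<nu>. p < u x) \<or> (AE x in \<nu>. u x < q)"
        using u by (intro besov_no_gap[OF finite_measure_axioms sp balls conn _ \<alpha> D c reg' _ pq(2)]) (auto simp: besov_space_def)
      then have "(AE x in \<nu>. s < u x) \<or> (AE x in \<nu>. u x < t)"
      proof (rule disj_forward)
        show "AE x in \<nu>. s < u x" if "AE x in \<nu>. p < u x"
          using that by eventually_elim (use pq in simp)
        show "AE x in \<nu>. u x < t" if "AE x in \<nu>. u x < q"
          using that by eventually_elim (use pq in simp)
      qed
      then show False using s t by blast
    qed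
  qed
  then show ?thesis by (simp add: \<nu>_def)
qed

theorem theorem4p6:
  fixes N :: nat and S :: "nat \<Rightarrow> 'a::euclidean_space \<Rightarrow> 'a" and r :: "nat \<Rightarrow> real"
    and K :: "'a set" and \<alpha> :: real
  assumes "N \<ge> 2"
    and "\<forall>i<N. 0 < r i \<and> r i < 1 \<and> similitude (S i) (r i)"
    and "open_set_condition N S"
    and "self_similar_set N S K"
    and "(\<Sum>i<N. r i powr \<alpha>) = 1"
    and "connected K"
    and "\<exists>\<beta>>\<alpha>. ae_has_nonconstant (normalized_hausdorff \<alpha> K) (besov_space (normalized_hausdorff \<alpha> K) \<alpha> \<beta>)"
  shows "beta2_star (normalized_hausdorff \<alpha> K) \<alpha> = beta3_star (normalized_hausdorff \<alpha> K) \<alpha>"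
proof (rule antisym)
  \<comment> \<open>With a nonpositive exponent each summand would be at least 1, and at least two
    such summands cannot add up to 1.\<close>
  have \<alpha>: "0 < \<alpha>"
  proof (rule ccontr)
    assume "\<not> 0 < \<alpha>"
    then have "1 \<le> r i powr \<alpha>" if "i < N" for i
      using assms(2) that powr_mono'[of \<alpha> 0 "r i"] by auto
    then have "real (card {..<N}) * 1 \<le> (\<Sum>i<N. r i powr \<alpha>)"
      by (intro sum_bounded_below) auto
    then show False using assms(1,5) by simp
  qed
  define \<nu> where "\<nu> = normalized_hausdorff \<alpha> K"
  note inf = besov_space_nonconstant_imp_infinite_dimensional[OF assms(2,4,6) \<alpha>, folded \<nu>_def]
  show "beta2_star (normalized_hausdorff \<alpha> K) \<alpha> \<le> beta3_star (normalized_hausdorff \<alpha> K) \<alpha>"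
    unfolding beta2_star_def beta3_star_def
    by (intro Sup_subset_mono image_mono) (auto intro: ae_infinite_dimensional_imp_nonconstant)
  obtain \<beta>0 where \<beta>0: "\<alpha> < \<beta>0" "ae_infinite_dimensional \<nu> (besov_space \<nu> \<alpha> \<beta>0)"
    using assms(7) inf unfolding \<nu>_def[symmetric] by blast
  have "ereal \<beta> \<le> beta2_star \<nu> \<alpha>" if "0 < \<beta>" "ae_has_nonconstant \<nu> (besov_space \<nu> \<alpha> \<beta>)" for \<beta>
  proof -
    \<comment> \<open>Above \<open>\<alpha>\<close> the exponent is its own witness. At or below
      \<open>\<alpha>\<close> the gap argument does not apply, and the larger
      \<open>\<beta>0\<close> serves instead.\<close>
    have "\<exists>\<beta>'\<ge>\<beta>. 0 < \<beta>' \<and> ae_infinite_dimensional \<nu> (besov_space \<nu> \<alpha> \<beta>')"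
      using that inf[of \<beta>] \<beta>0 \<alpha> by (cases "\<alpha> < \<beta>") (force intro: exI[of _ \<beta>0])+
    then show ?thesis unfolding beta2_star_def by (auto intro!: Sup_upper2[OF imageI])
  qed
  then show "beta3_star (normalized_hausdorff \<alpha> K) \<alpha> \<le> beta2_star (normalized_hausdorff \<alpha> K) \<alpha>"
    unfolding \<nu>_def[symmetric] by (subst beta3_star_def) (auto intro!: Sup_least)
qed

end
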